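(* The apex family of genuine pairs is completely parametrized by \[ s_A(t)=\frac{2(t+1)}{2t^2+t+1},\qquad \rho_A(t)=\frac{4t^4+4t^3+3t^2-2t-1}{(2t^2+t+1)^2}, \] where $t\in(-1,0)\cap\mathbb{Q}$ and $t\neq-\frac12$. That is, for every such $t$ these formulas give a genuine apex pair (with $\rho=\rho_A(t)$ and $s=\sqrt{2(1-\rho)}=s_A(t)$), and every genuine apex pair arises in this way from exactly one such $t$.
   Context: For $\rho\in\mathbb{Q}\cap(-1,1)$ and $q,u\in\mathbb{Q}$ consider triangles given by their triples of side lengths: \[ \tau(q)=\bigl(2(\rho-q),\,1-q^{2},\,q^{2}-2\rho q+1\bigr),\qquad \iota(u)=\bigl(2(1-\rho^{2}-u^{2}),\,u^{2}-\rho^{2}+1,\,u^{2}-\rho^{2}+1\bigr). \] The angle between the first two sides of $\tau(q)$ is the angle $\theta$ with $\cos\theta=\rho$. The triangle $\tau(q)$ is non-degenerate iff $|q|<1$ and $q<\rho$; $\iota(u)$ is an isosceles triangle, non-degenerate iff $-\sqrt{1-\rho^2}<u<0$ (or, as a triple with positive area, no other $u$). For $k\in\mathbb{Q}^\times$, $k\tau(q)$ is the rescaled triangle. The pair $(k\tau(q),\iota(u))$ is a genuine pair if both triangles are non-degenerate, they have equal perimeter and equal area, i.e. \[ k(1-q)=2(1-\rho),\qquad k^2(\rho-q)(1-q^2)=-2u(1-\rho^2-u^2), \] and they are not congruent. A genuine apex pair is a genuine pair $(k\tau(q),\iota(u))$ with $s:=\sqrt{2(1-\rho)}\in\mathbb{Q}$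 and $q=1-s$ (then necessarily $k=s$); in this case $\tau(q)$ is isosceles and $\theta$ is its apex angle (the angle between the two equal sides). The apex family is the set of all genuine apex pairs, over all $\rho\in\mathbb{Q}\cap(-1,1)$. *)

theory Defs
  imports Complex_Main "HOL-Library.Multiset"
begin

type_synonym triple = "real \<times> real \<times> real"

text \<open>The strict triangle inequalities already force all three sides to be positive.\<close>
fun nondegenerate :: "triple \<Rightarrow> bool" where
  "nondegenerate (a, b, c) \<longleftrightarrow> a < b + c \<and> b < c + a \<and> c < a + b"

fun perimeter :: "triple \<Rightarrow> real" where
  "perimeter (a, b, c) = a + b + c"

text \<open>Heron's formula.\<close>
fun area :: "triple \<Rightarrow> real" where
  "area (a, b, c) =
     (let p = (a + b + c) / 2 in sqrt (p * (p - a) * (p - b) * (p - c)))"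

fun congruent :: "triple \<Rightarrow> triple \<Rightarrow> bool" where
  "congruent (a, b, c) (a', b', c') \<longleftrightarrow> {#a, b, c#} = {#a', b', c'#}"

fun rescale :: "real \<Rightarrow> triple \<Rightarrow> triple" where
  "rescale k (a, b, c) = (k * a, k * b, k * c)"

definition tau :: "real \<Rightarrow> real \<Rightarrow> triple" where
  "tau \<rho> q = (2 * (\<rho> - q), 1 - q\<^sup>2, q\<^sup>2 - 2 * \<rho> * q + 1)"

definition iota :: "real \<Rightarrow> real \<Rightarrow> triple" where
  "iota \<rho> u = (2 * (1 - \<rho>\<^sup>2 - u\<^sup>2), u\<^sup>2 - \<rho>\<^sup>2 + 1, u\<^sup>2 - \<rho>\<^sup>2 + 1)"

text \<open>
  A pair is recorded by its parameters: \<open>genuine_pair \<rho> k q u\<close> refers to the triangles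
  \<open>rescale k (tau \<rho> q)\<close> and \<open>iota \<rho> u\<close>.  Since \<open>iota \<rho> u = iota \<rho> (- u)\<close>, the condition
  \<open>u < 0\<close> has to be added to the triangle inequalities to obtain the parameter range
  \<open>- sqrt (1 - \<rho>\<^sup>2) < u < 0\<close>; it is the normalisation under which equality of areas reads
  \<open>k\<^sup>2 * (\<rho> - q) * (1 - q\<^sup>2) = - 2 * u * (1 - \<rho>\<^sup>2 - u\<^sup>2)\<close>.
\<close>
definition genuine_pair :: "real \<Rightarrow> real \<Rightarrow> real \<Rightarrow> real \<Rightarrow> bool" where
  "genuine_pair \<rho> k q u \<longleftrightarrow>
     \<rho> \<in> \<rat> \<and> - 1 < \<rho> \<and> \<rho> < 1 \<and> k \<in> \<rat> \<and> k \<noteq> 0 \<and> q \<in> \<rat> \<and> u \<in> \<rat> \<and>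
     nondegenerate (rescale k (tau \<rho> q)) \<and>
     nondegenerate (iota \<rho> u) \<and> u < 0 \<and>
     perimeter (rescale k (tau \<rho> q)) = perimeter (iota \<rho> u) \<and>
     area (rescale k (tau \<rho> q)) = area (iota \<rho> u) \<and>
     \<not> congruent (rescale k (tau \<rho> q)) (iota \<rho> u)"

definition genuine_apex_pair :: "real \<Rightarrow> real \<Rightarrow> real \<Rightarrow> real \<Rightarrow> bool" where
  "genuine_apex_pair \<rho> k q u \<longleftrightarrow>
     genuine_pair \<rho> k q u \<and>
     sqrt (2 * (1 - \<rho>)) \<in> \<rat> \<and> q = 1 - sqrt (2 * (1 - \<rho>))"

definition apex_family :: "(real \<times> real \<times> real \<times> real) set" where
  "apex_family = {(\<rho>, k, q, u). genuine_apex_pair \<rho> k q u}"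

definition s_A :: "real \<Rightarrow> real" where
  "s_A t = 2 * (t + 1) / (2 * t\<^sup>2 + t + 1)"

definition rho_A :: "real \<Rightarrow> real" where
  "rho_A t = (4 * t ^ 4 + 4 * t ^ 3 + 3 * t\<^sup>2 - 2 * t - 1) / (2 * t\<^sup>2 + t + 1)\<^sup>2"

definition apex_params :: "real set" where
  "apex_params = {t \<in> \<rat>. - 1 < t \<and> t < 0 \<and> t \<noteq> - 1 / 2}"

end

theory Submission
  imports Defs
begin

text \<open>
  Put \<open>\<rho> = 1 - s\<^sup>2 / 2\<close> with \<open>0 < s < 2\<close>, so that \<open>s = sqrt (2 * (1 - \<rho>))\<close>.  At \<open>q = 1 - s\<close> the
  triangle \<open>tau \<rho> q\<close> is similar to \<open>(1, 1, s)\<close>, and equality of perimeters forces \<open>k = s\<close>.  Both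
  areas are \<open>sqrt (1 - \<rho>\<^sup>2)\<close> times a polynomial, and equality of areas becomes a cubic equation
  for \<open>u\<close>.  That cubic has the root \<open>u = - s * (2 - s) / 2\<close>, for which the two triangles are
  congruent.  Splitting off this root leaves the quadratic
  \<open>2 * u\<^sup>2 - s * (2 - s) * u - s ^ 3 * (2 - s) = 0\<close>, so for rational \<open>s\<close> the genuine
  apex pairs are exactly its negative rational solutions other than the congruent one (lemma \<open>genuine_apex_pair_iff\<close>).

  With \<open>u = s * v\<close> the quadratic is a conic in \<open>(s, v)\<close> through the rational point \<open>(0, 0)\<close>; the
  slope \<open>t = v / s = u / s\<^sup>2\<close> of the line through that point parametrizes it, and solving for \<open>s\<close>
  gives \<open>s = s_A t\<close> (lemma \<open>residual_quadratic_iff\<close>).  The congruent root lies on the conic only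
  for \<open>s = 1\<close>, that is for \<open>t = - 1 / 2\<close>, which explains the excluded parameter.  Finally \<open>s\<close>
  determines \<open>t\<close>: for given \<open>s\<close> in \<open>(0, 2)\<close> the equation \<open>s = s_A t\<close> is quadratic in \<open>t\<close> with roots of
  opposite signs (lemma \<open>s_A_inject\<close>).
\<close>

section \<open>The two triangles for an apex angle\<close>

lemma rescale_tau_apex:
  "rescale k (tau (1 - s\<^sup>2 / 2) (1 - s)) = (k * (s * (2 - s)), k * (s * (2 - s)), k * (s\<^sup>2 * (2 - s)))"
  by (simp add: tau_def) (simp add: algebra_simps power2_eq_square power3_eq_cube)

lemma one_minus_rho_square: "1 - (1 - s\<^sup>2 / 2)\<^sup>2 = s\<^sup>2 * (4 - s\<^sup>2) / 4" for s :: real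
  by (simp add: field_simps power2_eq_square)

text \<open>
  Half of base times height: the base of \<open>iota \<rho> u\<close> is \<open>2 * (1 - \<rho>\<^sup>2 - u\<^sup>2)\<close> and its height is \<open>2 * \<bar>u\<bar> * sqrt (1 - \<rho>\<^sup>2)\<close>.
\<close>
lemma area_iota: "area (iota \<rho> u) = sqrt (1 - \<rho>\<^sup>2) * (2 * \<bar>u * (1 - \<rho>\<^sup>2 - u\<^sup>2)\<bar>)"
proof -
  have "area (iota \<rho> u) = sqrt ((1 - \<rho>\<^sup>2) * (2 * (u * (1 - \<rho>\<^sup>2 - u\<^sup>2)))\<^sup>2)"
    unfolding iota_def area.simps Let_def
    by (rule arg_cong[where f = sqrt]) algebra
  also have "\<dots> = sqrt (1 - \<rho>\<^sup>2) * (2 * \<bar>u * (1 - \<rho>\<^sup>2 - u\<^sup>2)\<bar>)"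
    by (simp add: real_sqrt_mult abs_mult)
  finally show ?thesis .
qed

lemma area_isosceles_apex:
  "area (s * (s * (2 - s)), s * (s * (2 - s)), s * (s\<^sup>2 * (2 - s)))
     = sqrt (1 - (1 - s\<^sup>2 / 2)\<^sup>2) * (s ^ 4 * (2 - s)\<^sup>2 / 2)"
proof -
  have "area (s * (s * (2 - s)), s * (s * (2 - s)), s * (s\<^sup>2 * (2 - s)))
      = sqrt ((1 - (1 - s\<^sup>2 / 2)\<^sup>2) * (s ^ 4 * (2 - s)\<^sup>2 / 2)\<^sup>2)"
    unfolding area.simps Let_def
    by (rule arg_cong[where f = sqrt])
      (simp add: field_simps power2_eq_square, algebra)
  also have "\<dots> = sqrt (1 - (1 - s\<^sup>2 / 2)\<^sup>2) * (s ^ 4 * (2 - s)\<^sup>2 / 2)"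
    by (simp add: real_sqrt_mult abs_mult)
  finally show ?thesis .
qed

lemma congruent_isosceles_iff: "congruent (x, x, y) (a, b, b) \<longleftrightarrow> x = b \<and> y = a"
  by (auto simp: add_eq_conv_ex)

section \<open>The equation for genuine apex pairs\<close>

text \<open>
  The left-hand side is equality of areas after division by \<open>sqrt (1 - \<rho>\<^sup>2)\<close>, for \<open>u < 0\<close> and a
  positive base of \<open>iota \<rho> u\<close>.  On the right, the linear factor is the root of the cubic that comes
  from the congruent pair.
\<close>
lemma equal_area_factorization:
  "s ^ 4 * (2 - s)\<^sup>2 / 2 = 2 * (- u * (s\<^sup>2 * (4 - s\<^sup>2) / 4 - u\<^sup>2)) \<longleftrightarrow>
    (2 * u + s * (2 - s)) * (2 * u\<^sup>2 - s * (2 - s) * u - s ^ 3 * (2 - s)) = 0" for s u :: real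
proof -
  have "(2 * u + s * (2 - s)) * (2 * u\<^sup>2 - s * (2 - s) * u - s ^ 3 * (2 - s))
      = 2 * (2 * (- u * (s\<^sup>2 * (4 - s\<^sup>2) / 4 - u\<^sup>2)) - s ^ 4 * (2 - s)\<^sup>2 / 2)"
    by (simp add: field_simps power2_eq_square power3_eq_cube power4_eq_xxxx)
  then show ?thesis by auto
qed

lemma nondegenerate_iota_iff: "nondegenerate (iota \<rho> u) \<longleftrightarrow> u \<noteq> 0 \<and> u\<^sup>2 < 1 - \<rho>\<^sup>2"
proof -
  have "0 < u\<^sup>2 \<longleftrightarrow> u \<noteq> 0" by simp
  then show ?thesis unfolding iota_def nondegenerate.simps by argo
qed

lemma perimeter_eq_apex_iff:
  assumes "0 < s" "s < 2"
  shows "perimeter (rescale k (tau (1 - s\<^sup>2 / 2) (1 - s))) = perimeter (iota (1 - s\<^sup>2 / 2) u)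
    \<longleftrightarrow> k = s"
proof -
  have "perimeter (rescale k (tau (1 - s\<^sup>2 / 2) (1 - s))) - perimeter (iota (1 - s\<^sup>2 / 2) u)
      = s * (4 - s\<^sup>2) * (k - s)"
    unfolding rescale_tau_apex iota_def perimeter.simps
    by (simp add: field_simps power2_eq_square)
  moreover have "s * (4 - s\<^sup>2) \<noteq> 0"
  proof -
    have "4 - s\<^sup>2 = (2 - s) * (2 + s)" by (simp add: algebra_simps power2_eq_square)
    then show ?thesis using assms by simp
  qed
  ultimately show ?thesis by auto
qed

lemma congruent_apex_iff:
  assumes "0 < s" "s < 2" "u < 0"
  shows "congruent (rescale s (tau (1 - s\<^sup>2 / 2) (1 - s))) (iota (1 - s\<^sup>2 / 2) u)
    \<longleftrightarrow> 2 * u + s * (2 - s) = 0"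
proof -
  define R where "R = 1 - (1 - s\<^sup>2 / 2)\<^sup>2"
  have R: "R = s\<^sup>2 * (4 - s\<^sup>2) / 4" unfolding R_def by (rule one_minus_rho_square)
  have "congruent (rescale s (tau (1 - s\<^sup>2 / 2) (1 - s))) (iota (1 - s\<^sup>2 / 2) u)
    \<longleftrightarrow> s * (s * (2 - s)) = u\<^sup>2 + R \<and> s * (s\<^sup>2 * (2 - s)) = 2 * (R - u\<^sup>2)"
    unfolding rescale_tau_apex iota_def congruent_isosceles_iff R_def by (simp add: algebra_simps)
  also have "\<dots> \<longleftrightarrow> (2 * u)\<^sup>2 = (s * (2 - s))\<^sup>2"
    unfolding R by (auto simp: field_simps power2_eq_square)
  also have "\<dots> \<longleftrightarrow> 2 * u = s * (2 - s) \<or> 2 * u = - (s * (2 - s))"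
    by (rule power2_eq_iff)
  also have "\<dots> \<longleftrightarrow> 2 * u + s * (2 - s) = 0"
  proof -
    have "0 < s * (2 - s)" using assms by simp
    then show ?thesis using assms by linarith
  qed
  finally show ?thesis .
qed

lemma genuine_apex_pair_iff:
  assumes s: "0 < s" "s < 2" "s \<in> \<rat>"
  shows "genuine_apex_pair (1 - s\<^sup>2 / 2) k q u \<longleftrightarrow>
    k = s \<and> q = 1 - s \<and> u \<in> \<rat> \<and> u < 0 \<and>
    2 * u\<^sup>2 - s * (2 - s) * u - s ^ 3 * (2 - s) = 0 \<and> 2 * u + s * (2 - s) \<noteq> 0"
proof -
  define \<rho> where "\<rho> = 1 - s\<^sup>2 / 2"
  define D where "D = s\<^sup>2 * (4 - s\<^sup>2) / 4 - u\<^sup>2"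
  have D: "1 - \<rho>\<^sup>2 - u\<^sup>2 = D" unfolding \<rho>_def D_def one_minus_rho_square ..
  have "s\<^sup>2 < 2\<^sup>2" using s by (intro power_strict_mono) auto
  then have rho: "- 1 < \<rho>" "\<rho> < 1" "\<rho> \<in> \<rat>" using s by (auto simp: \<rho>_def)
  have sqrt_s: "sqrt (2 * (1 - \<rho>)) = s" using s by (simp add: \<rho>_def)
  have "\<rho>\<^sup>2 < 1" using rho by (simp add: abs_square_less_1)
  then have sin: "0 < sqrt (1 - \<rho>\<^sup>2)" by simp
  have nondeg_tau: "nondegenerate (rescale s (tau \<rho> (1 - s)))"
  proof -
    have "s * (2 - s) < 2 * (2 - s)" using s by (intro mult_strict_right_mono) auto
    then show ?thesis
      unfolding \<rho>_def rescale_tau_apex using s by (simp add: power2_eq_square)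
  qed
  have nondeg_iota: "nondegenerate (iota \<rho> u) \<longleftrightarrow> 0 < D" if "u < 0"
    using that by (auto simp: nondegenerate_iota_iff D[symmetric])
  have perim: "perimeter (rescale k (tau \<rho> (1 - s))) = perimeter (iota \<rho> u) \<longleftrightarrow> k = s"
    unfolding \<rho>_def using s by (intro perimeter_eq_apex_iff) auto
  have area: "area (rescale s (tau \<rho> (1 - s))) = area (iota \<rho> u) \<longleftrightarrow>
      s ^ 4 * (2 - s)\<^sup>2 / 2 = 2 * \<bar>u * D\<bar>"
  proof -
    have "area (rescale s (tau \<rho> (1 - s))) = sqrt (1 - \<rho>\<^sup>2) * (s ^ 4 * (2 - s)\<^sup>2 / 2)"
      unfolding \<rho>_def rescale_tau_apex by (rule area_isosceles_apex)
    moreover have "area (iota \<rho> u) = sqrt (1 - \<rho>\<^sup>2) * (2 * \<bar>u * D\<bar>)"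
      unfolding area_iota D ..
    ultimately show ?thesis using sin by (simp only: mult_cancel_left) simp
  qed
  \<comment> \<open>The absolute value disappears because the cubic equation alone already makes \<open>D\<close>, half the
    base of \<open>iota \<rho> u\<close>, positive.\<close>
  have pos: "0 < s ^ 4 * (2 - s)\<^sup>2 / 2" using s by simp
  have cubic: "0 < D \<and> s ^ 4 * (2 - s)\<^sup>2 / 2 = 2 * \<bar>u * D\<bar> \<longleftrightarrow>
      (2 * u + s * (2 - s)) * (2 * u\<^sup>2 - s * (2 - s) * u - s ^ 3 * (2 - s)) = 0" if "u < 0"
  proof -
    have "0 < D \<and> s ^ 4 * (2 - s)\<^sup>2 / 2 = 2 * \<bar>u * D\<bar> \<longleftrightarrow>
        s ^ 4 * (2 - s)\<^sup>2 / 2 = 2 * (- u * D)"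
    proof
      assume "0 < D \<and> s ^ 4 * (2 - s)\<^sup>2 / 2 = 2 * \<bar>u * D\<bar>"
      then show "s ^ 4 * (2 - s)\<^sup>2 / 2 = 2 * (- u * D)" using that by (simp add: abs_mult)
    next
      assume eq: "s ^ 4 * (2 - s)\<^sup>2 / 2 = 2 * (- u * D)"
      then have "0 < - u * D" using pos by linarith
      then have "0 < D" using that by (simp add: mult_less_0_iff)
      then show "0 < D \<and> s ^ 4 * (2 - s)\<^sup>2 / 2 = 2 * \<bar>u * D\<bar>"
        using eq that by (simp add: abs_mult)
    qed
    then show ?thesis unfolding D_def equal_area_factorization .
  qed
  have congr: "congruent (rescale s (tau \<rho> (1 - s))) (iota \<rho> u) \<longleftrightarrow> 2 * u + s * (2 - s) = 0"
    if "u < 0"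
    unfolding \<rho>_def using s that by (intro congruent_apex_iff) auto
  have "genuine_apex_pair \<rho> k q u \<longleftrightarrow> k = s \<and> q = 1 - s \<and> u \<in> \<rat> \<and> u < 0 \<and>
      (0 < D \<and> s ^ 4 * (2 - s)\<^sup>2 / 2 = 2 * \<bar>u * D\<bar>) \<and> 2 * u + s * (2 - s) \<noteq> 0"
    (is "?L \<longleftrightarrow> ?R")
  proof
    assume g: ?L
    then have q: "q = 1 - s" and u: "u < 0" "u \<in> \<rat>"
      unfolding genuine_apex_pair_def genuine_pair_def sqrt_s by blast+
    from g have "k = s"
      unfolding genuine_apex_pair_def genuine_pair_def q perim by blast
    with g show ?R
      unfolding genuine_apex_pair_def genuine_pair_def q \<open>k = s\<close>
        nondeg_iota[OF u(1)] area congr[OF u(1)] by blast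
  next
    assume R: ?R
    then have u: "u < 0" and kq: "k = s" "q = 1 - s" by blast+
    have "1 - s \<in> \<rat>" "s \<noteq> 0" using s by simp_all
    moreover have "perimeter (rescale s (tau \<rho> (1 - s))) = perimeter (iota \<rho> u)"
      using perim kq by blast
    ultimately show ?L
      unfolding genuine_apex_pair_def genuine_pair_def sqrt_s kq
        nondeg_iota[OF u] area congr[OF u]
      using R rho s nondeg_tau by (intro conjI; simp)
  qed
  moreover have "(0 < D \<and> s ^ 4 * (2 - s)\<^sup>2 / 2 = 2 * \<bar>u * D\<bar>) \<and> 2 * u + s * (2 - s) \<noteq> 0 \<longleftrightarrow>
      2 * u\<^sup>2 - s * (2 - s) * u - s ^ 3 * (2 - s) = 0 \<and> 2 * u + s * (2 - s) \<noteq> 0" if "u < 0"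
    unfolding cubic[OF that] mult_eq_0_iff by blast
  ultimately show ?thesis unfolding \<rho>_def[symmetric] by blast
qed

section \<open>The rational parametrization\<close>

lemma denominator_pos: "0 < 2 * t\<^sup>2 + t + 1" for t :: real
proof -
  have "2 * t\<^sup>2 + t + 1 = 2 * (t + 1 / 4)\<^sup>2 + 7 / 8"
    by (simp add: field_simps power2_eq_square)
  moreover have "0 \<le> 2 * (t + 1 / 4)\<^sup>2" by simp
  ultimately show ?thesis by linarith
qed

lemma rho_A_eq: "rho_A t = 1 - (s_A t)\<^sup>2 / 2"
proof -
  define d where "d = 2 * t\<^sup>2 + t + 1"
  have "d \<noteq> 0" using denominator_pos[of t] by (simp add: d_def)
  have "4 * t ^ 4 + 4 * t ^ 3 + 3 * t\<^sup>2 - 2 * t - 1 = d\<^sup>2 - 2 * (t + 1)\<^sup>2"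
    by (simp add: d_def algebra_simps power2_eq_square power3_eq_cube power4_eq_xxxx)
  then have "rho_A t = (d\<^sup>2 - 2 * (t + 1)\<^sup>2) / d\<^sup>2" by (simp add: rho_A_def d_def)
  also have "\<dots> = 1 - (2 * (t + 1) / d)\<^sup>2 / 2"
    using \<open>d \<noteq> 0\<close> by (simp add: field_simps power2_eq_square)
  finally show ?thesis by (simp add: s_A_def d_def)
qed

lemma s_A_eq_iff: "s = s_A t \<longleftrightarrow> 2 * s * t\<^sup>2 = (2 - s) * (t + 1)"
proof -
  have "s = s_A t \<longleftrightarrow> s * (2 * t\<^sup>2 + t + 1) = 2 * (t + 1)"
    unfolding s_A_def by (rule nonzero_eq_divide_eq[OF denominator_pos[THEN less_imp_neq, symmetric]])
  then show ?thesis by argo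
qed

lemma s_A_pos_iff: "0 < s_A t \<longleftrightarrow> - 1 < t"
proof -
  have "0 < s_A t \<longleftrightarrow> 0 * (2 * t\<^sup>2 + t + 1) < 2 * (t + 1)"
    unfolding s_A_def by (rule pos_less_divide_eq[OF denominator_pos])
  then show ?thesis by auto
qed

lemma s_A_less_2:
  assumes "t \<noteq> 0"
  shows "s_A t < 2"
proof -
  have "0 < t\<^sup>2" using assms by simp
  then have "2 * (t + 1) < 2 * (2 * t\<^sup>2 + t + 1)" by argo
  then show ?thesis unfolding s_A_def pos_divide_less_eq[OF denominator_pos] .
qed

text \<open>
  If \<open>t \<noteq> t'\<close> are both negative and have the same value \<open>s\<close>, they are the two roots of
  \<open>2 * s * t\<^sup>2 - (2 - s) * t - (2 - s) = 0\<close>, whose product is negative since \<open>0 < s < 2\<close>.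
\<close>
lemma s_A_inject:
  assumes "- 1 < t" "t < 0" "- 1 < t'" "t' < 0" "s_A t = s_A t'"
  shows "t = t'"
proof (rule ccontr)
  assume "t \<noteq> t'"
  define s where "s = s_A t"
  have s: "0 < s" "s < 2" using assms s_A_pos_iff[of t] s_A_less_2[of t] by (simp_all add: s_def)
  have 1: "2 * s * t\<^sup>2 = (2 - s) * (t + 1)" using s_A_eq_iff[of s t] s_def by blast
  have 2: "2 * s * t'\<^sup>2 = (2 - s) * (t' + 1)" using s_A_eq_iff[of s t'] s_def assms(5) by blast
  have "(t - t') * (2 * s * t * t' + (2 - s)) = 0"
    using 1 2 by algebra
  then have "2 * s * (t * t') + (2 - s) = 0" using \<open>t \<noteq> t'\<close> by (simp add: mult.assoc)
  moreover have "0 < s * (t * t')" using s assms by (simp add: mult_neg_neg)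
  ultimately show False using s by linarith
qed

text \<open>
  Substituting \<open>u = t * s\<^sup>2\<close> makes the quadratic divisible by \<open>s ^ 3\<close>, and the remaining factor is
  linear in \<open>s\<close>: a line of slope \<open>t\<close> through the point \<open>(0, 0)\<close> of the conic meets it in only one
  further point.
\<close>
lemma residual_quadratic_iff:
  assumes "0 < s"
  shows "2 * (t * s\<^sup>2)\<^sup>2 - s * (2 - s) * (t * s\<^sup>2) - s ^ 3 * (2 - s) = 0 \<longleftrightarrow> s = s_A t"
proof -
  have "2 * (t * s\<^sup>2)\<^sup>2 - s * (2 - s) * (t * s\<^sup>2) - s ^ 3 * (2 - s)
      = s ^ 3 * (2 * s * t\<^sup>2 - (2 - s) * (t + 1))"
    by algebra
  then show ?thesis using assms by (simp add: s_A_eq_iff)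
qed

text \<open>The congruent pair occurs on the conic only at \<open>s = 1\<close>, where \<open>t = - 1 / 2\<close>.\<close>
lemma congruent_parameter_iff:
  assumes "- 1 < t" "t < 0"
  shows "2 * (t * (s_A t)\<^sup>2) + s_A t * (2 - s_A t) = 0 \<longleftrightarrow> t = - 1 / 2"
proof
  define s where "s = s_A t"
  have s: "0 < s" "s < 2" using assms s_A_pos_iff[of t] s_A_less_2[of t] by (simp_all add: s_def)
  assume "2 * (t * (s_A t)\<^sup>2) + s_A t * (2 - s_A t) = 0"
  then have "s * (2 * t * s + 2 - s) = 0"
    by (simp add: s_def[symmetric] algebra_simps power2_eq_square)
  then have 1: "2 - s = - 2 * t * s" using s by simp
  have "2 * s * t\<^sup>2 = (2 - s) * (t + 1)" using s_A_eq_iff[of s t] s_def by blast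
  then have "(2 * s * t) * (2 * t + 1) = 0" unfolding 1 by (simp add: algebra_simps power2_eq_square)
  then show "t = - 1 / 2" using s assms by auto
next
  assume "t = - 1 / 2"
  then show "2 * (t * (s_A t)\<^sup>2) + s_A t * (2 - s_A t) = 0"
    by (simp add: s_A_def power2_eq_square)
qed

text \<open>
  The slope parameter of an apex pair is \<open>t = u / s\<^sup>2\<close>; it is negative because \<open>u\<close> is, and \<open>0 < s\<close>
  is what bounds it below by \<open>- 1\<close>.
\<close>
lemma apex_family_iff:
  "(\<rho>, k, q, u) \<in> apex_family \<longleftrightarrow>
    (\<exists>t \<in> apex_params. \<rho> = rho_A t \<and> k = s_A t \<and> q = 1 - s_A t \<and> u = t * (s_A t)\<^sup>2)"
proof
  assume "(\<rho>, k, q, u) \<in> apex_family"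
  then have g: "genuine_apex_pair \<rho> k q u" by (simp add: apex_family_def)
  define s where "s = sqrt (2 * (1 - \<rho>))"
  define t where "t = u / s\<^sup>2"
  have rho: "- 1 < \<rho>" "\<rho> < 1" and "s \<in> \<rat>"
    using g by (auto simp: genuine_apex_pair_def genuine_pair_def s_def)
  have "sqrt (2 * (1 - \<rho>)) < sqrt 4" unfolding real_sqrt_less_iff using rho by simp
  then have s: "0 < s" "s < 2" using rho by (auto simp: s_def)
  have \<rho>: "\<rho> = 1 - s\<^sup>2 / 2" using rho by (simp add: s_def field_simps)
  have u: "u = t * s\<^sup>2" using s by (simp add: t_def)
  have eqs: "k = s" "q = 1 - s" "u \<in> \<rat>" "u < 0"
      "2 * u\<^sup>2 - s * (2 - s) * u - s ^ 3 * (2 - s) = 0" "2 * u + s * (2 - s) \<noteq> 0"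
    using g unfolding \<rho> genuine_apex_pair_iff[OF s \<open>s \<in> \<rat>\<close>] by auto
  have s_eq: "s = s_A t" using eqs(5) s(1) unfolding u by (simp only: residual_quadratic_iff)
  have "t < 0" using eqs(4) s by (simp add: t_def divide_neg_pos)
  moreover have "- 1 < t" using s s_eq s_A_pos_iff[of t] by simp
  moreover have "t \<in> \<rat>" using eqs(3) \<open>s \<in> \<rat>\<close> by (simp add: t_def)
  moreover have "t \<noteq> - 1 / 2"
    using eqs(6) congruent_parameter_iff[OF \<open>- 1 < t\<close> \<open>t < 0\<close>] u s_eq by simp
  ultimately have "t \<in> apex_params" by (simp add: apex_params_def)
  moreover have "\<rho> = rho_A t" using \<rho> s_eq rho_A_eq[of t] by simp
  ultimately show "\<exists>t \<in> apex_params. \<rho> = rho_A t \<and> k = s_A t \<and> q = 1 - s_A t \<and> u = t * (s_A t)\<^sup>2"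
    using eqs(1,2) u unfolding s_eq by blast
next
  assume "\<exists>t \<in> apex_params. \<rho> = rho_A t \<and> k = s_A t \<and> q = 1 - s_A t \<and> u = t * (s_A t)\<^sup>2"
  then obtain t where t: "- 1 < t" "t < 0" "t \<noteq> - 1 / 2" "t \<in> \<rat>"
    and eqs: "\<rho> = rho_A t" "k = s_A t" "q = 1 - s_A t" "u = t * (s_A t)\<^sup>2"
    by (auto simp: apex_params_def)
  have s: "0 < s_A t" "s_A t < 2" using t s_A_pos_iff[of t] s_A_less_2[of t] by simp_all
  have "s_A t \<in> \<rat>" using t(4) by (simp add: s_A_def)
  moreover have "t * (s_A t)\<^sup>2 < 0" using s t by (simp add: mult_neg_pos)
  ultimately show "(\<rho>, k, q, u) \<in> apex_family"
    using t congruent_parameter_iff[OF t(1,2)] residual_quadratic_iff[OF s(1), of t]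
    unfolding apex_family_def eqs rho_A_eq
    by (simp add: genuine_apex_pair_iff[OF s])
qed

lemma sqrt_rho_A: "- 1 < t \<Longrightarrow> sqrt (2 * (1 - rho_A t)) = s_A t"
  using s_A_pos_iff[of t] by (simp add: rho_A_eq)

theorem theorem5p2:
  shows "(\<forall>t \<in> apex_params.
            sqrt (2 * (1 - rho_A t)) = s_A t \<and>
            (\<exists>!u. (rho_A t, s_A t, 1 - s_A t, u) \<in> apex_family)) \<and>
         (\<forall>(\<rho>, k, q, u) \<in> apex_family.
            \<exists>!t. t \<in> apex_params \<and>
                 \<rho> = rho_A t \<and> sqrt (2 * (1 - \<rho>)) = s_A t \<and>
                 k = s_A t \<and> q = 1 - s_A t)"
proof -
  have inj: "t = t'" if "t \<in> apex_params" "t' \<in> apex_params" "s_A t = s_A t'" for t t'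
    using that s_A_inject by (auto simp: apex_params_def)
  have sqrt: "sqrt (2 * (1 - rho_A t)) = s_A t" if "t \<in> apex_params" for t
    using that sqrt_rho_A by (simp add: apex_params_def)
  have "\<exists>!u. (rho_A t, s_A t, 1 - s_A t, u) \<in> apex_family" if "t \<in> apex_params" for t
  proof (rule ex1I)
    show "(rho_A t, s_A t, 1 - s_A t, t * (s_A t)\<^sup>2) \<in> apex_family"
      unfolding apex_family_iff using that by blast
    show "u = t * (s_A t)\<^sup>2" if u: "(rho_A t, s_A t, 1 - s_A t, u) \<in> apex_family" for u
      using u inj[OF \<open>t \<in> apex_params\<close>] unfolding apex_family_iff by auto
  qed
  moreover have "\<exists>!t. t \<in> apex_params \<and> \<rho> = rho_A t \<and> sqrt (2 * (1 - \<rho>)) = s_A t \<and>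
      k = s_A t \<and> q = 1 - s_A t" if "(\<rho>, k, q, u) \<in> apex_family" for \<rho> k q u
    using that sqrt inj unfolding apex_family_iff by metis
  ultimately show ?thesis
    unfolding Ball_def split_paired_All prod.case using sqrt by blast
qed

end
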